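(* For every complex $q$ with $|q|<1$ and every $z\in\mathbb{C}\setminus\{0\}$, \[ \sum_{n=0}^{\infty}\frac{(q/z;q)_{n+1}(z;q)_n\,q^{n^2+n}}{(q;q)_{2n+1}}= \frac{(q^2z,\,q/z,\,q^3;q^3)_{\infty}}{(q;q)_{\infty}}. \]
   Context: Notation: $(x;q)_n=(1-x)(1-xq)\cdots(1-xq^{n-1})$, $(x;q)_\infty=\prod_{k\ge0}(1-xq^k)$, and $(x_1,\dots,x_k;q)_n=(x_1;q)_n\cdots(x_k;q)_n$ (also for $n=\infty$). *)

theory Defs
  imports "HOL-Analysis.Analysis"
begin

definition qpoch :: "complex \<Rightarrow> complex \<Rightarrow> nat \<Rightarrow> complex" where
  "qpoch x q n = (\<Prod>k<n. 1 - x * q ^ k)"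

(* prodinf permits finitely many vanishing factors (the product is then 0);
   for norm q < 1 the product converges for every x. *)
definition qpoch_inf :: "complex \<Rightarrow> complex \<Rightarrow> complex" where
  "qpoch_inf x q = (\<Prod>k. 1 - x * q ^ k)"

end

theory Submission
  imports Defs
begin

text \<open>
  Expand \<open>(q/z; q)_(n+1) (z; q)_n / (q; q)_(2n+1)\<close> by the finite Jacobi triple product as
  \<open>\<Sum>j\<in>\<int>. (-1)^j z^j q^(j(j-1)/2) / ((q; q)_(n-j) (q; q)_(n+1+j))\<close> and sum over \<open>n\<close> first.
  By the Durfee rectangle identity \<open>\<Sum>m. q^(m^2+ma) / ((q; q)_m (q; q)_(m+a)) = 1 / (q; q)_\<infinity>\<close>
  the inner sum is \<open>q^(j^2+j) / (q; q)_\<infinity>\<close>. What remains is the theta series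
  \<open>\<Sum>j\<in>\<int>. (-1)^j z^j q^((3j^2+j)/2)\<close>, a Jacobi triple product in base \<open>q^3\<close>.
  The Durfee rectangle sum \<open>F a\<close> satisfies \<open>F a - F (a+1) = -q^(a+1) (F (a+1) - F (a+2))\<close> and is
  bounded, hence it is constant in \<open>a\<close>, and its limit for \<open>a \<rightarrow> \<infinity>\<close> is \<open>1 / (q; q)_\<infinity>\<close>.
\<close>

section \<open>Finite \<open>q\<close>-Pochhammer symbols\<close>

lemma qpoch_0 [simp]: "qpoch x q 0 = 1"
  by (simp add: qpoch_def)

lemma qpoch_Suc: "qpoch x q (Suc n) = qpoch x q n * (1 - x * q ^ n)"
  by (simp add: qpoch_def)

lemma qpoch_add: "qpoch x q (m + n) = qpoch x q m * qpoch (x * q ^ m) q n"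
  by (induction n) (simp_all add: qpoch_Suc power_add mult_ac)

lemma qpoch_self_Suc: "qpoch q q (Suc n) = qpoch q q n * (1 - q ^ Suc n)"
  by (simp add: qpoch_Suc)

lemma power_neq_1_if_norm_less_1:
  fixes q :: complex
  assumes "norm q < 1"
  shows "q ^ Suc n \<noteq> 1"
proof
  assume "q ^ Suc n = 1"
  hence "norm q ^ Suc n = 1"
    by (metis norm_one norm_power)
  moreover have "norm q ^ Suc n < 1"
    using assms power_Suc_le_self[of "norm q" n] by simp
  ultimately show False by simp
qed

lemma qpoch_self_nonzero:
  assumes "norm q < 1"
  shows "qpoch q q n \<noteq> 0"
  using power_neq_1_if_norm_less_1[OF assms]
  by (induction n) (auto simp: qpoch_self_Suc simp del: power_Suc)

text \<open>This is the finite q-binomial theorem divided by \<open>qpoch q q N\<close>, so that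
  each q-binomial coefficient turns into two reciprocal factors. In this form the induction on
  \<open>N\<close> needs only the first-order recurrence of \<open>g\<close>.\<close>

lemma qpoch_binomial_sum:
  assumes q: "norm q < 1"
  shows "(\<Sum>k\<le>N. (- x) ^ k * q ^ (k choose 2) / (qpoch q q k * qpoch q q (N - k)))
    = qpoch x q N / qpoch q q N"
proof (induction N)
  case 0
  show ?case by (simp add: binomial_eq_0)
next
  case (Suc N)
  define g where "g k = (- x) ^ k * q ^ (k choose 2) / qpoch q q k" for k
  have g: "(1 - q ^ Suc k) * g (Suc k) = - x * q ^ k * g k" for k
  proof -
    have "Suc k choose 2 = k + (k choose 2)"
      by (simp add: numeral_2_eq_2)
    thus ?thesis
      using qpoch_self_nonzero[OF q, of k] power_neq_1_if_norm_less_1[OF q, of k]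
      by (simp add: g_def qpoch_self_Suc power_add del: power_Suc) (simp add: field_simps)
  qed
  have nz: "1 - q ^ Suc n \<noteq> 0" for n
    using power_neq_1_if_norm_less_1[OF q, of n] by simp
  have IH: "(\<Sum>k\<le>N. g k / qpoch q q (N - k)) = qpoch x q N / qpoch q q N"
    using Suc by (simp add: g_def)
  \<comment> \<open>The weight splits as
    \<open>(1 - q ^ (Suc N - k)) + q ^ (Suc N - k) * (1 - q ^ k)\<close>. The first part cancels the
    last factor of \<open>qpoch q q (Suc N - k)\<close>, the second triggers the recurrence of
    \<open>g\<close>. The terms \<open>k = Suc N\<close> and \<open>k = 0\<close> vanish
    respectively, so both sums shrink to level \<open>N\<close>, with ratio
    \<open>- x * q ^ N\<close> free of \<open>k\<close>.\<close>
  have "(1 - q ^ Suc N) * (\<Sum>k\<le>Suc N. g k / qpoch q q (Suc N - k))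
      = (\<Sum>k\<le>Suc N. (1 - q ^ (Suc N - k)) * g k / qpoch q q (Suc N - k))
        + (\<Sum>k\<le>Suc N. q ^ (Suc N - k) * ((1 - q ^ k) * g k) / qpoch q q (Suc N - k))"
    unfolding sum_distrib_left sum.distrib[symmetric]
  proof (rule sum.cong[OF refl])
    fix k assume "k \<in> {..Suc N}"
    hence "q ^ Suc N = q ^ (Suc N - k) * q ^ k"
      by (metis atMost_iff le_add_diff_inverse2 power_add)
    thus "(1 - q ^ Suc N) * (g k / qpoch q q (Suc N - k)) =
      (1 - q ^ (Suc N - k)) * g k / qpoch q q (Suc N - k)
        + q ^ (Suc N - k) * ((1 - q ^ k) * g k) / qpoch q q (Suc N - k)"
      by (simp only: add_divide_distrib[symmetric] times_divide_eq_right) (simp add: algebra_simps)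
  qed
  also have "(\<Sum>k\<le>Suc N. (1 - q ^ (Suc N - k)) * g k / qpoch q q (Suc N - k))
      = (\<Sum>k\<le>N. g k / qpoch q q (N - k))"
    using nz by (auto simp: Suc_diff_le qpoch_self_Suc simp del: power_Suc intro!: sum.cong)
  also have "(\<Sum>k\<le>Suc N. q ^ (Suc N - k) * ((1 - q ^ k) * g k) / qpoch q q (Suc N - k))
      = (\<Sum>k\<le>N. q ^ (N - k) * ((1 - q ^ Suc k) * g (Suc k)) / qpoch q q (N - k))"
    by (subst sum.atMost_Suc_shift) simp
  also have "\<dots> = (\<Sum>k\<le>N. - x * q ^ N * (g k / qpoch q q (N - k)))"
  proof (rule sum.cong[OF refl])
    fix k assume "k \<in> {..N}"
    hence "q ^ N = q ^ (N - k) * q ^ k"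
      by (metis atMost_iff le_add_diff_inverse2 power_add)
    thus "q ^ (N - k) * ((1 - q ^ Suc k) * g (Suc k)) / qpoch q q (N - k)
        = - x * q ^ N * (g k / qpoch q q (N - k))"
      unfolding g by simp
  qed
  also have "(\<Sum>k\<le>N. g k / qpoch q q (N - k)) + \<dots>
      = (1 - x * q ^ N) * (qpoch x q N / qpoch q q N)"
    unfolding sum_distrib_left[symmetric] IH by (simp add: left_diff_distrib diff_divide_distrib)
  finally have "(1 - q ^ Suc N) * (\<Sum>k\<le>Suc N. g k / qpoch q q (Suc N - k)) = \<dots>" .
  hence "(\<Sum>k\<le>Suc N. g k / qpoch q q (Suc N - k))
      = (1 - x * q ^ N) * (qpoch x q N / qpoch q q N) / (1 - q ^ Suc N)"
    using nonzero_mult_div_cancel_left[OF nz[of N]] by metis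
  also have "\<dots> = qpoch x q (Suc N) / qpoch q q (Suc N)"
    by (simp only: qpoch_self_Suc qpoch_Suc[of x]) simp
  finally have "(\<Sum>k\<le>Suc N. g k / qpoch q q (Suc N - k)) = \<dots>" .
  thus ?case by (simp add: g_def del: sum.atMost_Suc)
qed

lemma choose_two_add: "(m + n) choose 2 = (m choose 2) + (n choose 2) + m * n"
  by (induction n) (simp_all add: numeral_2_eq_2)

lemma choose_two_double: "2 * (n choose 2) + n = n * n"
  by (induction n) (simp_all add: numeral_2_eq_2)

text \<open>Factor by factor, \<open>(1 - a / q ^ j) * q ^ j = - a * (1 - b * q ^ (j - 1))\<close>
  for \<open>j = 1, ..., m\<close>, because \<open>q / a = b\<close>; the powers
  \<open>q ^ j\<close> multiply to \<open>q ^ (Suc m choose 2)\<close>.\<close>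

lemma qpoch_divide_power:
  assumes ab: "a * b = q" and q0: "q \<noteq> 0"
  shows "qpoch (a / q ^ m) q m * q ^ (Suc m choose 2) = (- a) ^ m * qpoch b q m"
proof (induction m)
  case 0
  show ?case by (simp add: binomial_eq_0)
next
  case (Suc m)
  have "qpoch (a / q ^ Suc m) q (Suc m) = (1 - a / q ^ Suc m) * qpoch (a / q ^ m) q m"
    using qpoch_add[of "a / q ^ Suc m" q 1 m] q0 by (simp add: qpoch_Suc)
  moreover have "Suc (Suc m) choose 2 = Suc m + (Suc m choose 2)"
    by (simp add: numeral_2_eq_2)
  ultimately have "qpoch (a / q ^ Suc m) q (Suc m) * q ^ (Suc (Suc m) choose 2)
      = ((1 - a / q ^ Suc m) * q ^ Suc m) * (qpoch (a / q ^ m) q m * q ^ (Suc m choose 2))"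
    by (simp add: power_add mult_ac)
  also have "(1 - a / q ^ Suc m) * q ^ Suc m = - a * (1 - b * q ^ m)"
    using q0 ab by (simp add: algebra_simps)
  finally show ?case unfolding Suc by (simp add: qpoch_Suc mult_ac)
qed

section \<open>The Jacobi triple product\<close>

text \<open>With \<open>b = q / a\<close> this is the sum of the terms \<open>j = i\<close> and \<open>j = -i-1\<close> of
  \<open>\<Sum>j\<in>\<int>. (-1)^j a^j q^(j(j-1)/2)\<close>; the two-parameter form avoids negative powers.\<close>

definition theta_pair :: "complex \<Rightarrow> complex \<Rightarrow> complex \<Rightarrow> nat \<Rightarrow> complex" where
  "theta_pair a b q i = (- a) ^ i * q ^ (i choose 2) + (- b) ^ Suc i * q ^ (Suc i choose 2)"

text \<open>Take the q-binomial sum with \<open>N = 2 * n + 1\<close> at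
  \<open>x = a / q ^ Suc n\<close>: the first \<open>Suc n\<close> factors of the product turn into
  the \<open>b\<close> part, the other \<open>n\<close> give the \<open>a\<close> part. Of the
  \<open>2 * n + 2\<close> terms, those with \<open>k = n + 1 + i\<close> and
  \<open>k = n - i\<close> have the same denominator and form one \<open>theta_pair\<close>.\<close>

lemma finite_jacobi_triple_product:
  assumes q: "norm q < 1" and q0: "q \<noteq> 0" and ab: "a * b = q"
  shows "qpoch b q (Suc n) * qpoch a q n / qpoch q q (2 * n + 1)
    = (\<Sum>i\<le>n. theta_pair a b q i / (qpoch q q (n - i) * qpoch q q (n + 1 + i)))"
proof -
  define m where "m = Suc n"
  have a0: "a \<noteq> 0" using q0 ab by auto
  \<comment> \<open>The last factor clears the negative powers of \<open>q\<close> that the shift by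
    \<open>q ^ m\<close> brings in.\<close>
  define t where "t k = (- (a / q ^ m)) ^ k * q ^ (k choose 2) * q ^ (Suc m choose 2)" for k
  define d where "d k = qpoch q q k * qpoch q q (m + n - k)" for k
  have t: "t k = (- a) ^ k * q ^ ((k choose 2) + (Suc m choose 2)) / q ^ (m * k)" for k
    unfolding t_def minus_divide_left power_divide by (simp add: power_add power_mult)
  have t1: "t (m + i) = (- a) ^ m * ((- a) ^ i * q ^ (i choose 2))" for i
  proof -
    have "(m + i choose 2) + (Suc m choose 2) = (i choose 2) + m * (m + i)"
      using choose_two_double[of m]
      by (simp add: choose_two_add distrib_left, simp add: numeral_2_eq_2)
    hence "q ^ ((m + i choose 2) + (Suc m choose 2)) = q ^ (i choose 2) * q ^ (m * (m + i))"
      by (simp only: power_add)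
    thus ?thesis
      unfolding t using q0 by (simp add: power_add)
  qed
  \<comment> \<open>This is the theta term of index \<open>-s\<close>: the missing \<open>s\<close>
    powers of \<open>- a\<close> are supplied by
    \<open>q ^ s = (- a) ^ s * (- b) ^ s\<close>.\<close>
  have t2: "t k = (- a) ^ m * ((- b) ^ s * q ^ (s choose 2))" if ks: "k + s = m" for k s
  proof -
    have "(k choose 2) + (Suc m choose 2) = s + (s choose 2) + m * k"
      using choose_two_double[of k]
      by (simp add: ks[symmetric] choose_two_add distrib_right numeral_2_eq_2)
        (use choose_two_add[of k s] in \<open>simp add: numeral_2_eq_2\<close>)
    moreover have "q ^ s = (- a) ^ s * (- b) ^ s"
      by (simp add: ab[symmetric] flip: power_mult_distrib)
    ultimately have "q ^ ((k choose 2) + (Suc m choose 2))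
        = (- a) ^ s * (- b) ^ s * q ^ (s choose 2) * q ^ (m * k)"
      by (simp only: power_add)
    thus ?thesis
      unfolding t using q0 by (simp add: power_add flip: ks)
  qed
  have "(\<Sum>k\<le>m + n. t k / d k)
      = q ^ (Suc m choose 2) * (\<Sum>k\<le>m + n. (- (a / q ^ m)) ^ k * q ^ (k choose 2) / d k)"
    by (simp add: t_def sum_distrib_left mult_ac)
  also have "\<dots> = q ^ (Suc m choose 2) * (qpoch (a / q ^ m) q (m + n) / qpoch q q (m + n))"
    unfolding d_def by (simp only: qpoch_binomial_sum[OF q])
  also have "\<dots> = (qpoch (a / q ^ m) q m * q ^ (Suc m choose 2)) * qpoch a q n / qpoch q q (m + n)"
    using q0 by (simp add: qpoch_add[of "a / q ^ m"])
  also have "\<dots> = (- a) ^ m * (qpoch b q m * qpoch a q n / qpoch q q (m + n))"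
    unfolding qpoch_divide_power[OF ab q0] by simp
  finally have eq: "(\<Sum>k\<le>m + n. t k / d k) = \<dots>" .
  have "{..m + n} = {..n} \<union> (\<lambda>i. m + i) ` {..n}"
  proof (intro equalityI subsetI)
    fix k assume "k \<in> {..m + n}"
    thus "k \<in> {..n} \<union> (\<lambda>i. m + i) ` {..n}"
      by (cases "k \<le> n") (auto simp: m_def intro!: image_eqI[of _ _ "k - m"])
  qed (auto simp: m_def)
  hence "(\<Sum>k\<le>m + n. t k / d k)
      = (\<Sum>k\<le>n. t k / d k) + (\<Sum>k\<in>(\<lambda>i. m + i) ` {..n}. t k / d k)"
    by (simp only:) (rule sum.union_disjoint, auto simp: m_def)
  also have "(\<Sum>k\<in>(\<lambda>i. m + i) ` {..n}. t k / d k) = (\<Sum>i\<le>n. t (m + i) / d (m + i))"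
    by (subst sum.reindex) auto
  also have "(\<Sum>k\<le>n. t k / d k) = (\<Sum>i\<le>n. t (n - i) / d (n - i))"
    by (rule sum.reindex_bij_witness[of _ "\<lambda>i. n - i" "\<lambda>i. n - i"]) auto
  also have "\<dots> + (\<Sum>i\<le>n. t (m + i) / d (m + i))
      = (\<Sum>i\<le>n. (- a) ^ m * (theta_pair a b q i / (qpoch q q (n - i) * qpoch q q (n + 1 + i))))"
    unfolding sum.distrib[symmetric]
  proof (rule sum.cong[OF refl])
    fix i assume i: "i \<in> {..n}"
    have "d (n - i) = qpoch q q (n - i) * qpoch q q (n + 1 + i)"
      using i by (simp add: d_def m_def)
    moreover have "d (m + i) = qpoch q q (n - i) * qpoch q q (n + 1 + i)"
      by (simp add: d_def m_def)
    moreover have "t (n - i) = (- a) ^ m * ((- b) ^ Suc i * q ^ (Suc i choose 2))"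
      by (rule t2) (use i in \<open>simp add: m_def\<close>)
    ultimately show "t (n - i) / d (n - i) + t (m + i) / d (m + i)
      = (- a) ^ m * (theta_pair a b q i / (qpoch q q (n - i) * qpoch q q (n + 1 + i)))"
      unfolding t1 theta_pair_def by (simp add: add_divide_distrib distrib_left del: power_Suc)
  qed
  finally have "qpoch b q m * qpoch a q n / qpoch q q (m + n)
      = (\<Sum>i\<le>n. theta_pair a b q i / (qpoch q q (n - i) * qpoch q q (n + 1 + i)))"
    unfolding eq sum_distrib_left[symmetric]
    by (rule mult_left_cancel[THEN iffD1, rotated]) (simp add: a0)
  moreover have "m + n = 2 * n + 1"
    by (simp add: m_def)
  ultimately show ?thesis by (simp only: m_def)
qed

section \<open>Infinite products and limits under the summation sign\<close>

lemma convergent_prod_qpoch: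
  fixes q :: complex
  assumes "norm q < 1"
  shows "convergent_prod (\<lambda>k. 1 - x * q ^ k)"
proof -
  have "summable (\<lambda>k. norm (- x * q ^ k))"
    using assms by (auto simp: norm_mult norm_power intro!: summable_mult summable_geometric)
  thus ?thesis
    by (intro abs_convergent_prod_imp_convergent_prod summable_imp_abs_convergent_prod) simp
qed

lemma qpoch_tendsto_qpoch_inf:
  assumes "norm q < 1"
  shows "qpoch x q \<longlonglongrightarrow> qpoch_inf x q"
proof (rule LIMSEQ_imp_Suc)
  show "(\<lambda>n. qpoch x q (Suc n)) \<longlonglongrightarrow> qpoch_inf x q"
    using convergent_prod_LIMSEQ[OF convergent_prod_qpoch[OF assms, of x]]
    by (simp add: qpoch_def qpoch_inf_def lessThan_Suc_atMost del: prod.lessThan_Suc)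
qed

lemma qpoch_inf_self_nonzero:
  assumes "norm q < 1"
  shows "qpoch_inf q q \<noteq> 0"
  unfolding qpoch_inf_def
  by (rule prodinf_nonzero[OF convergent_prod_qpoch])
    (use assms power_neq_1_if_norm_less_1[OF assms] in auto)

lemma inverse_qpoch_self_tendsto:
  assumes "norm q < 1"
  shows "(\<lambda>n. 1 / qpoch q q n) \<longlonglongrightarrow> 1 / qpoch_inf q q"
  by (intro tendsto_divide tendsto_const qpoch_tendsto_qpoch_inf qpoch_inf_self_nonzero assms)

lemma inverse_qpoch_self_bounded:
  assumes "norm q < 1"
  obtains K where "K > 0" "\<And>n. norm (1 / qpoch q q n) \<le> K"
  using BseqE[OF convergent_imp_Bseq[OF convergentI[OF inverse_qpoch_self_tendsto[OF assms]]]]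
  by blast

text \<open>Dominated convergence for sums whose range grows with \<open>n\<close>: extend the terms
  by zero beyond \<open>k = n\<close>, which for fixed \<open>k\<close> changes only finitely many
  \<open>n\<close>.\<close>

lemma tannery_triangular:
  fixes f :: "nat \<Rightarrow> nat \<Rightarrow> complex"
  assumes lim: "\<And>k. (\<lambda>n. f n k) \<longlonglongrightarrow> b k"
    and bound: "\<And>n k. k \<le> n \<Longrightarrow> norm (f n k) \<le> M k" and "summable M"
  shows "(\<lambda>n. \<Sum>k\<le>n. f n k) \<longlonglongrightarrow> suminf b"
proof -
  define a where "a k n = (if k \<le> n then f n k else 0)" for k n
  have M0: "M k \<ge> 0" for k
    using bound[of k k] norm_ge_zero order_trans by blast
  have lim': "(\<lambda>n. a k n) \<longlonglongrightarrow> b k" for k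
    using lim[of k]
    by (rule Lim_transform_eventually)
      (auto simp: a_def eventually_at_top_linorder intro!: exI[of _ k])
  have "eventually (\<lambda>(k, n). norm (a k n) \<le> M k) (at_top \<times>\<^sub>F sequentially)"
    by (rule always_eventually) (auto simp: a_def bound M0)
  from tannerys_theorem[OF lim' this \<open>summable M\<close>]
  have "(\<lambda>n. \<Sum>k. a k n) \<longlonglongrightarrow> suminf b"
    by auto
  moreover have "(\<Sum>k. a k n) = (\<Sum>k\<le>n. f n k)" for n
    by (subst suminf_finite[of "{..n}"]) (auto simp: a_def)
  ultimately show ?thesis
    by simp
qed

text \<open>Consecutive terms have ratio \<open>norm x * norm q ^ n\<close>, which tends to zero for
  every \<open>x\<close>.\<close>

lemma summable_power_choose_two:
  fixes q :: complex
  assumes "norm q < 1"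
  shows "summable (\<lambda>i. norm (x ^ i * q ^ (i choose 2)))"
proof -
  have "(\<lambda>n. norm x * norm q ^ n) \<longlonglongrightarrow> norm x * 0"
    using assms by (intro tendsto_intros LIMSEQ_power_zero) auto
  hence "eventually (\<lambda>n. norm x * norm q ^ n < 1 / 2) sequentially"
    by (rule order_tendstoD) simp
  then obtain N where N: "\<And>n. n \<ge> N \<Longrightarrow> norm x * norm q ^ n < 1 / 2"
    by (auto simp: eventually_at_top_linorder)
  show ?thesis
  proof (rule summable_ratio_test[of "1 / 2" N])
    fix n assume n: "n \<ge> N"
    have "Suc n choose 2 = n + (n choose 2)"
      by (simp add: numeral_2_eq_2)
    hence "norm (norm (x ^ Suc n * q ^ (Suc n choose 2)))
        = (norm x * norm q ^ n) * norm (norm (x ^ n * q ^ (n choose 2)))"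
      by (simp add: norm_mult norm_power power_add mult_ac)
    also have "\<dots> \<le> 1 / 2 * norm (norm (x ^ n * q ^ (n choose 2)))"
      using N[OF n] by (intro mult_right_mono) auto
    finally show "norm (norm (x ^ Suc n * q ^ (Suc n choose 2)))
        \<le> 1 / 2 * norm (norm (x ^ n * q ^ (n choose 2)))" .
  qed simp
qed

lemma summable_norm_theta_pair:
  assumes "norm q < 1"
  shows "summable (\<lambda>i. norm (theta_pair a b q i))"
proof (rule summable_comparison_test')
  show "summable (\<lambda>i. norm ((- a) ^ i * q ^ (i choose 2))
      + norm ((- b) ^ Suc i * q ^ (Suc i choose 2)))"
    using summable_power_choose_two[OF assms, of "- b"]
    by (intro summable_add summable_power_choose_two assms) (subst summable_Suc_iff)
  show "norm (norm (theta_pair a b q i)) \<le> norm ((- a) ^ i * q ^ (i choose 2))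
      + norm ((- b) ^ Suc i * q ^ (Suc i choose 2))" if "i \<ge> 0" for i
    by (simp add: theta_pair_def norm_triangle_ineq del: power_Suc)
qed

text \<open>Let \<open>n\<close> tend to infinity in the finite version. Each denominator on the
  series side tends to \<open>E * E\<close>, the one on the product side to \<open>E\<close>, which
  leaves a single factor \<open>E\<close> with the product.\<close>

theorem jacobi_triple_product:
  assumes q: "norm q < 1" and q0: "q \<noteq> 0" and ab: "a * b = q"
  shows "theta_pair a b q sums (qpoch_inf a q * qpoch_inf b q * qpoch_inf q q)"
proof -
  define E where "E = qpoch_inf q q"
  have E0: "E \<noteq> 0" unfolding E_def by (rule qpoch_inf_self_nonzero[OF q])
  define f where "f n i = theta_pair a b q i / (qpoch q q (n - i) * qpoch q q (n + 1 + i))" for n i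
  obtain K where K: "K > 0" "\<And>n. norm (1 / qpoch q q n) \<le> K"
    using inverse_qpoch_self_bounded[OF q] by blast
  have f: "f n i = theta_pair a b q i * ((1 / qpoch q q (n - i)) * (1 / qpoch q q (n + (1 + i))))" for n i
    by (simp add: f_def)
  have lim: "(\<lambda>n. f n i) \<longlonglongrightarrow> theta_pair a b q i * ((1 / E) * (1 / E))" for i
    unfolding f E_def
    by (intro tendsto_mult tendsto_const LIMSEQ_ignore_initial_segment inverse_qpoch_self_tendsto[OF q]
        filterlim_compose[OF inverse_qpoch_self_tendsto[OF q] filterlim_minus_const_nat_at_top])
  \<comment> \<open>Since \<open>K\<close> bounds all reciprocals \<open>1 / qpoch q q n\<close>,
    this majorant does not depend on \<open>n\<close>.\<close>
  have bound: "norm (f n i) \<le> norm (theta_pair a b q i) * (K * K)" for n i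
    unfolding f norm_mult using K by (intro mult_left_mono mult_mono) auto
  have "summable (\<lambda>i. norm (theta_pair a b q i) * (K * K))"
    by (intro summable_mult2 summable_norm_theta_pair q)
  note T = tannery_triangular[OF lim bound this]
  have S: "summable (theta_pair a b q)"
    using summable_norm_theta_pair[OF q] by (rule summable_norm_cancel)
  have "suminf (\<lambda>i. theta_pair a b q i * ((1 / E) * (1 / E))) = suminf (theta_pair a b q) * ((1 / E) * (1 / E))"
    by (rule suminf_mult2[OF S, symmetric])
  with T have L1: "(\<lambda>n. \<Sum>i\<le>n. f n i) \<longlonglongrightarrow> suminf (theta_pair a b q) * ((1 / E) * (1 / E))"
    by simp
  have sub: "strict_mono (\<lambda>n::nat. 2 * n + 1)"
    by (auto simp: strict_mono_def)
  have "(\<lambda>n. qpoch b q (Suc n) * qpoch a q n * (1 / qpoch q q (2 * n + 1)))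
      \<longlonglongrightarrow> qpoch_inf b q * qpoch_inf a q * (1 / E)"
    unfolding E_def
    using LIMSEQ_subseq_LIMSEQ[OF inverse_qpoch_self_tendsto[OF q] sub]
    by (intro tendsto_mult qpoch_tendsto_qpoch_inf q LIMSEQ_Suc) (simp add: o_def)
  hence L2: "(\<lambda>n. \<Sum>i\<le>n. f n i) \<longlonglongrightarrow> qpoch_inf b q * qpoch_inf a q * (1 / E)"
    using finite_jacobi_triple_product[OF q q0 ab] by (simp add: f_def)
  from LIMSEQ_unique[OF L1 L2] have "suminf (theta_pair a b q) = qpoch_inf a q * qpoch_inf b q * E"
    using E0 by (simp add: field_simps)
  with summable_sums[OF S] show ?thesis
    by (simp add: E_def)
qed

section \<open>The Durfee rectangle identity\<close>

text \<open>Combinatorially, partitions are sorted by the largest \<open>m\<close> by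
  \<open>m + a\<close> rectangle in their diagram. The argument here is analytic: the sum
  \<open>F a\<close> does not depend on \<open>a\<close>, and only its term \<open>m = 0\<close>
  survives as \<open>a\<close> grows.\<close>

lemma durfee_rectangle:
  assumes q: "norm q < 1"
  shows "(\<lambda>m. q ^ (m * m + m * a) / (qpoch q q m * qpoch q q (m + a))) sums (1 / qpoch_inf q q)"
proof -
  obtain K where K: "K > 0" "\<And>n. norm (1 / qpoch q q n) \<le> K"
    using inverse_qpoch_self_bounded[OF q] by blast
  define f where "f a m = q ^ (m * m + m * a) / (qpoch q q m * qpoch q q (m + a))" for a m
  define F where "F a = suminf (f a)" for a
  \<comment> \<open>This majorant is uniform in \<open>a\<close>; it gives summability, a common
    bound on all \<open>F a\<close>, and the final passage to the limit.\<close>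
  define M where "M m = norm q ^ m * (K * K)" for m
  have M: "summable M"
    unfolding M_def using q by (intro summable_mult2 summable_geometric) auto
  have f: "f a m = q ^ (m * m + m * a) * ((1 / qpoch q q m) * (1 / qpoch q q (m + a)))" for a m
    by (simp add: f_def)
  have bound: "norm (f a m) \<le> M m" for a m
  proof -
    have "m \<le> m * m + m * a"
      by (cases m) auto
    hence "norm q ^ (m * m + m * a) \<le> norm q ^ m"
      using q by (intro power_decreasing) auto
    thus ?thesis
      unfolding f M_def norm_mult norm_power using K by (intro mult_mono) auto
  qed
  have summ: "summable (f a)" for a
    using M bound by (rule summable_comparison_test'[where N = 0])
  have nz: "qpoch q q n \<noteq> 0" "1 - q ^ Suc n \<noteq> 0" for n
    using qpoch_self_nonzero[OF q] power_neq_1_if_norm_less_1[OF q, of n] by auto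
  txt \<open>In the difference, split \<open>1 - q^(m+a+1) - q^m\<close> as \<open>(1 - q^m) - q^(m+a+1)\<close> and shift the first part.\<close>
  have rec: "F a - F (Suc a) = - (q ^ Suc a) * (F (Suc a) - F (Suc (Suc a)))" for a
  proof -
    define u where "u m = (1 - q ^ m) * q ^ (m * m + m * a) / (qpoch q q m * qpoch q q (m + Suc a))" for m
    have diff: "f a m - f (Suc a) m = u m - q ^ Suc a * f (Suc a) m" for m
    proof -
      have "f a m = (1 - q ^ Suc (m + a)) * q ^ (m * m + m * a) / (qpoch q q m * qpoch q q (m + Suc a))"
        using nz by (simp add: f_def qpoch_self_Suc del: power_Suc)
      thus ?thesis
        by (simp add: f_def u_def diff_divide_distrib[symmetric])
          (simp add: algebra_simps power_add)
    qed
    \<comment> \<open>The factor \<open>1 - q ^ m\<close> kills the term \<open>m = 0\<close>, so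
      shifting the index loses nothing.\<close>
    have u0: "u 0 = 0" by (simp add: u_def)
    have u: "u (Suc m) = q ^ Suc a * f (Suc (Suc a)) m" for m
      using nz by (simp add: u_def f_def qpoch_self_Suc[of _ m] del: power_Suc)
        (simp add: power_add algebra_simps)
    have "(\<lambda>m. u (Suc m)) sums (q ^ Suc a * F (Suc (Suc a)))"
      unfolding u F_def by (intro sums_mult summable_sums summ)
    hence "u sums (q ^ Suc a * F (Suc (Suc a)))"
      by (subst (asm) sums_Suc_iff) (simp add: u0)
    hence "(\<lambda>m. u m - q ^ Suc a * f (Suc a) m) sums (q ^ Suc a * F (Suc (Suc a)) - q ^ Suc a * F (Suc a))"
      unfolding F_def by (intro sums_diff sums_mult summable_sums summ)
    moreover have "(\<lambda>m. f a m - f (Suc a) m) sums (F a - F (Suc a))"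
      unfolding F_def by (intro sums_diff summable_sums summ)
    ultimately show ?thesis
      unfolding diff using sums_unique2 by (fastforce simp: algebra_simps)
  qed
  have Fbound: "norm (F a) \<le> suminf M" for a
    unfolding F_def by (rule norm_suminf_le[OF bound M])
  \<comment> \<open>Each use of \<open>rec\<close> gains a factor of norm at most
    \<open>norm q\<close> and moves \<open>a\<close> to \<open>Suc a\<close>, hence the induction
    over all \<open>a\<close> at once. Letting \<open>k\<close> grow forces the difference to be
    zero.\<close>
  have decay: "norm (F a - F (Suc a)) \<le> norm q ^ k * (2 * suminf M)" for a k
  proof (induction k arbitrary: a)
    case 0
    show ?case
      using norm_triangle_ineq4[of "F a" "F (Suc a)"] Fbound[of a] Fbound[of "Suc a"] by simp
  next
    case (Suc k)
    have "norm (F a - F (Suc a)) = norm q ^ Suc a * norm (F (Suc a) - F (Suc (Suc a)))"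
      unfolding rec[of a] by (simp add: norm_mult norm_power)
    also have "\<dots> \<le> norm q * (norm q ^ k * (2 * suminf M))"
      using q Suc[of "Suc a"] power_le_one[of "norm q" a]
      by (intro mult_mono) (auto intro: mult_left_le)
    finally show ?case by simp
  qed
  have "F a = F (Suc a)" for a
  proof -
    have "(\<lambda>k. norm q ^ k * (2 * suminf M)) \<longlonglongrightarrow> 0 * (2 * suminf M)"
      using q by (intro tendsto_intros LIMSEQ_power_zero) auto
    hence "norm (F a - F (Suc a)) \<le> 0 * (2 * suminf M)"
      by (rule Lim_bounded2) (use decay in auto)
    thus ?thesis by simp
  qed
  hence const: "F a = F 0" for a
    by (induction a) simp_all
  have lim: "(\<lambda>a. f a m) \<longlonglongrightarrow> (if m = 0 then 1 / qpoch_inf q q else 0)" for m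
  proof (cases "m = 0")
    case True
    thus ?thesis using inverse_qpoch_self_tendsto[OF q] by (simp add: f_def)
  next
    case False
    have null: "(\<lambda>a. norm q ^ a * (K * K)) \<longlonglongrightarrow> 0"
      using q by (intro tendsto_mult_left_zero LIMSEQ_power_zero) auto
    have "norm (f a m) \<le> norm q ^ a * (K * K)" for a
    proof -
      have "a \<le> m * m + m * a"
        using False by (cases m) auto
      hence "norm q ^ (m * m + m * a) \<le> norm q ^ a"
        using q by (intro power_decreasing) auto
      thus ?thesis
        unfolding f norm_mult norm_power using K by (intro mult_mono) auto
    qed
    hence "(\<lambda>a. f a m) \<longlonglongrightarrow> 0"
      by (intro Lim_null_comparison[OF _ null] always_eventually allI)
    with False show ?thesis by simp
  qed
  have "eventually (\<lambda>(m, a). norm (f a m) \<le> M m) (at_top \<times>\<^sub>F sequentially)"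
    by (rule always_eventually) (auto simp: bound)
  from tannerys_theorem[OF lim this M]
  have "F \<longlonglongrightarrow> (\<Sum>m. if m = 0 then 1 / qpoch_inf q q else 0)"
    by (simp add: F_def[abs_def])
  also have "(\<Sum>m::nat. if m = 0 then 1 / qpoch_inf q q else 0) = 1 / qpoch_inf q q"
    by (subst suminf_finite[of "{0}"]) auto
  finally have "F \<longlonglongrightarrow> 1 / qpoch_inf q q" .
  moreover have "F \<longlonglongrightarrow> F a"
    by (intro tendsto_eventually always_eventually allI) (metis const)
  ultimately have "F a = 1 / qpoch_inf q q"
    using LIMSEQ_unique by blast
  with summable_sums[OF summ[of a]] show ?thesis
    by (simp add: F_def f_def[abs_def])
qed

section \<open>Summation over the theta series\<close>

text \<open>A partial sum over diagonals runs over the triangle \<open>i + m \<le> n\<close>, so it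
  equals a sum of truncated rows. Row \<open>i\<close> tends to \<open>s i\<close> and is dominated
  by \<open>A i / (1 - r)\<close>, so dominated convergence applies.\<close>

lemma sums_triangular_interchange:
  fixes g :: "nat \<Rightarrow> nat \<Rightarrow> complex"
  assumes g: "\<And>i. g i sums s i"
    and bound: "\<And>i m. norm (g i m) \<le> A i * r ^ m"
    and A: "summable A" and r: "0 \<le> r" "r < 1"
  shows "(\<lambda>n. \<Sum>i\<le>n. g i (n - i)) sums suminf s"
proof -
  have A0: "A i \<ge> 0" for i
    using order_trans[OF norm_ge_zero bound[of i 0]] by simp
  have lim: "(\<lambda>n. \<Sum>m\<le>n - i. g i m) \<longlonglongrightarrow> s i" for i
    using g[of i] unfolding sums_def_le
    by (rule filterlim_compose[OF _ filterlim_minus_const_nat_at_top])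
  have bd: "norm (\<Sum>m\<le>n - i. g i m) \<le> A i * (1 / (1 - r))" for n i
  proof -
    have "norm (\<Sum>m\<le>n - i. g i m) \<le> (\<Sum>m\<le>n - i. A i * r ^ m)"
      by (intro sum_norm_le bound)
    also have "\<dots> = A i * (\<Sum>m\<le>n - i. r ^ m)"
      by (simp add: sum_distrib_left)
    also have "(\<Sum>m\<le>n - i. r ^ m) \<le> (\<Sum>m. r ^ m)"
      using r by (intro sum_le_suminf summable_geometric) auto
    also have "(\<Sum>m. r ^ m) = 1 / (1 - r)"
      using r by (intro suminf_geometric) auto
    finally show ?thesis using A0 by (simp add: mult_left_mono)
  qed
  have "(\<lambda>n. \<Sum>i\<le>n. \<Sum>m\<le>n - i. g i m) \<longlonglongrightarrow> suminf s"
    by (rule tannery_triangular[OF lim bd summable_mult2[OF A]])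
  moreover have "(\<Sum>i\<le>n. \<Sum>m\<le>n - i. g i m) = (\<Sum>k\<le>n. \<Sum>i\<le>k. g i (k - i))" for n
  proof -
    have "(\<Sum>i\<le>n. \<Sum>m\<le>n - i. g i m) = (\<Sum>(i, m)\<in>Sigma {..n} (\<lambda>i. {..n - i}). g i m)"
      by (rule sum.Sigma) auto
    also have "Sigma {..n} (\<lambda>i. {..n - i}) = {(i, m). i + m \<le> n}"
      by auto
    finally show ?thesis by (simp only: sum.triangle_reindex_eq)
  qed
  ultimately show ?thesis
    by (simp add: sums_def_le)
qed

text \<open>The exponent \<open>j^2 + j\<close> is the same at \<open>j = i\<close> and
  \<open>j = -i-1\<close>, so one factor serves both terms of the pair. Then
  \<open>j(j-1)/2 + j^2 + j = 3 j(j-1)/2 + 2 j\<close> shows the new base \<open>q ^ 3\<close> and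
  the new parameter \<open>q\<^sup>2 * z\<close>.\<close>

lemma theta_pair_rescale:
  assumes "z \<noteq> 0"
  shows "theta_pair z (q / z) q i * q ^ (i * i + i) = theta_pair (q\<^sup>2 * z) (q / z) (q ^ 3) i"
proof -
  have "(i choose 2) + (i * i + i) = 2 * i + 3 * (i choose 2)"
    using choose_two_double[of i] by simp
  hence 1: "q ^ (i choose 2) * q ^ (i * i + i) = (q\<^sup>2) ^ i * (q ^ 3) ^ (i choose 2)"
    by (metis power_add power_mult)
  have "(Suc i choose 2) + (i * i + i) = 3 * (Suc i choose 2)"
    using choose_two_double[of "Suc i"] by simp
  hence 2: "q ^ (Suc i choose 2) * q ^ (i * i + i) = (q ^ 3) ^ (Suc i choose 2)"
    by (metis power_add power_mult)
  have 3: "(- (q\<^sup>2 * z)) ^ i = (- z) ^ i * (q\<^sup>2) ^ i"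
    by (simp flip: power_mult_distrib add: mult_ac)
  show ?thesis
    unfolding theta_pair_def distrib_right mult.assoc 1 2 3 by simp
qed

theorem theorem3p3:
  fixes q z :: complex
  assumes "norm q < 1" and "z \<noteq> 0"
  shows "(\<lambda>n. qpoch (q / z) q (n + 1) * qpoch z q n * q ^ (n\<^sup>2 + n) / qpoch q q (2 * n + 1))
    sums (qpoch_inf (q\<^sup>2 * z) (q ^ 3) * qpoch_inf (q / z) (q ^ 3) * qpoch_inf (q ^ 3) (q ^ 3)
      / qpoch_inf q q)"
proof (cases "q = 0")
  case True
  \<comment> \<open>The triple product requires a nonzero base. For \<open>q = 0\<close> only the
    term \<open>n = 0\<close> remains, and both sides are 1.\<close>
  have "qpoch_inf 0 0 = 1" "qpoch 0 0 n = 1" for n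
    by (simp_all add: qpoch_inf_def qpoch_def)
  moreover have "(\<lambda>n. qpoch z 0 n * 0 ^ (n\<^sup>2 + n)) sums (\<Sum>n\<in>{0}. qpoch z 0 n * 0 ^ (n\<^sup>2 + n))"
    by (rule sums_finite) auto
  ultimately show ?thesis
    using True by simp
next
  case q0: False
  note q = assms(1)
  define E where "E = qpoch_inf q q"
  define T where "T = theta_pair z (q / z) q"
  \<comment> \<open>With \<open>n = i + m\<close> the denominators of the finite triple product
    become those of the Durfee sum for \<open>a = 2 * i + 1\<close>, and \<open>n^2 + n\<close>
    splits into \<open>i^2 + i\<close> plus the Durfee exponent.\<close>
  define D where "D i m = q ^ (m * m + m * (2 * i + 1)) / (qpoch q q m * qpoch q q (m + (2 * i + 1)))" for i m
  define g where "g i m = T i * q ^ (i * i + i) * D i m" for i m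
  obtain K where K: "K > 0" "\<And>n. norm (1 / qpoch q q n) \<le> K"
    using inverse_qpoch_self_bounded[OF q] by blast
  have g_sums: "g i sums (T i * q ^ (i * i + i) * (1 / E))" for i
    unfolding g_def D_def E_def by (intro sums_mult durfee_rectangle q)
  have bound: "norm (g i m) \<le> (norm (T i) * (K * K)) * norm q ^ m" for i m
  proof -
    \<comment> \<open>One factor \<open>q ^ m\<close> is set aside for the geometric majorant; the
      remaining power has norm at most 1.\<close>
    have g: "g i m = T i * (q ^ (i * i + i + m * m + m * (2 * i)) * q ^ m)
        * ((1 / qpoch q q m) * (1 / qpoch q q (m + (2 * i + 1))))"
      by (simp add: g_def D_def power_add algebra_simps)
    have "norm (g i m) \<le> norm (T i) * (1 * norm q ^ m) * (K * K)"
      unfolding g norm_mult norm_power using K q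
      by (intro mult_mono power_le_one mult_nonneg_nonneg) auto
    thus ?thesis by (simp add: mult_ac)
  qed
  have summand: "(\<Sum>i\<le>n. g i (n - i))
      = qpoch (q / z) q (n + 1) * qpoch z q n * q ^ (n\<^sup>2 + n) / qpoch q q (2 * n + 1)" for n
  proof -
    have "(\<Sum>i\<le>n. g i (n - i))
        = (\<Sum>i\<le>n. q ^ (n\<^sup>2 + n) * (T i / (qpoch q q (n - i) * qpoch q q (n + 1 + i))))"
    proof (rule sum.cong[OF refl])
      fix i assume "i \<in> {..n}"
      then obtain m where n: "n = i + m"
        by (auto simp: le_iff_add)
      have "n\<^sup>2 + n = (i * i + i) + (m * m + m * (2 * i + 1))"
        by (simp add: n power2_eq_square algebra_simps)
      hence "q ^ (n\<^sup>2 + n) = q ^ (i * i + i) * q ^ (m * m + m * (2 * i + 1))"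
        by (simp only: power_add)
      moreover have "n - i = m" "n + 1 + i = m + (2 * i + 1)"
        by (simp_all add: n)
      ultimately show "g i (n - i)
          = q ^ (n\<^sup>2 + n) * (T i / (qpoch q q (n - i) * qpoch q q (n + 1 + i)))"
        by (simp only: g_def D_def) simp
    qed
    also have "\<dots> = q ^ (n\<^sup>2 + n) * (qpoch (q / z) q (Suc n) * qpoch z q n / qpoch q q (2 * n + 1))"
      unfolding sum_distrib_left[symmetric] T_def
      using assms(2) by (subst finite_jacobi_triple_product[OF q q0]) auto
    finally show ?thesis by (simp add: mult_ac)
  qed
  have "norm (q ^ 3) < 1"
    using q power_Suc_less_one[of "norm q" 2] q0 by (simp add: norm_mult numeral_3_eq_3)
  moreover have "q\<^sup>2 * z * (q / z) = q ^ 3"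
    using assms(2) by (simp add: power2_eq_square power3_eq_cube)
  ultimately have "theta_pair (q\<^sup>2 * z) (q / z) (q ^ 3) sums
      (qpoch_inf (q\<^sup>2 * z) (q ^ 3) * qpoch_inf (q / z) (q ^ 3) * qpoch_inf (q ^ 3) (q ^ 3))"
    using q0 by (intro jacobi_triple_product) auto
  from sums_divide[OF this, of E]
  have "suminf (\<lambda>i. T i * q ^ (i * i + i) * (1 / E))
      = qpoch_inf (q\<^sup>2 * z) (q ^ 3) * qpoch_inf (q / z) (q ^ 3) * qpoch_inf (q ^ 3) (q ^ 3) / E"
    unfolding T_def theta_pair_rescale[OF assms(2)] by (simp add: sums_iff)
  moreover have "(\<lambda>n. \<Sum>i\<le>n. g i (n - i)) sums suminf (\<lambda>i. T i * q ^ (i * i + i) * (1 / E))"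
    by (rule sums_triangular_interchange[OF g_sums bound])
      (use q in \<open>auto simp: T_def intro!: summable_mult2 summable_norm_theta_pair\<close>)
  ultimately show ?thesis
    unfolding summand E_def by simp
qed

end
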